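(* Let $\delta$ and $\epsilon$ be rotations in a finite-dimensional Euclidean space $V$. Then $V$ decomposes into an orthogonal direct sum of subspaces, each of which is invariant under both $\delta$ and $\epsilon$, and has dimension either $1$, $2$ or $4$.
   Context: A Euclidean space is a real vector space $V$ with an inner product $\langle\,,\rangle$; $O(V)$ denotes the group of orthogonal endomorphisms of $V$. A rotation in $V$ is an orthogonal endomorphism $\delta\in O(V)$ such that (1) $\delta^2(v)\in\operatorname{span}\{v,\delta(v)\}$ and (2) $\langle v,\delta(v)\rangle=\langle w,\delta(w)\rangle$ for all unit vectors $v,w\in V$. (In particular $\pm$ the identity map are rotations.) *)

theory Defs
  imports "HOL-Analysis.Analysis"
begin

text \<open>
  Euclidean spaces are types of class \<open>real_inner\<close>; finite-dimensionality is a separate hypothesis.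
  The class \<open>euclidean_space\<close> is not used because it excludes the zero space.
\<close>

definition finite_dimensional :: "'a::real_vector itself \<Rightarrow> bool" where
  "finite_dimensional _ \<longleftrightarrow> (\<exists>B::'a set. finite B \<and> span B = UNIV)"

text \<open>
  In finite dimension the maps satisfying \<open>orthogonal_transformation\<close> are automatically bijective,
  so they are exactly the elements of \<open>O(V)\<close>.
\<close>

definition rotation :: "('a::real_inner \<Rightarrow> 'a) \<Rightarrow> bool" where
  "rotation \<delta> \<longleftrightarrow>
     orthogonal_transformation \<delta> \<and>
     (\<forall>v. \<delta> (\<delta> v) \<in> span {v, \<delta> v}) \<and>
     (\<forall>v w. norm v = 1 \<longrightarrow> norm w = 1 \<longrightarrow> v \<bullet> \<delta> v = w \<bullet> \<delta> w)"

definition invariant_under :: "('a \<Rightarrow> 'a) \<Rightarrow> 'a set \<Rightarrow> bool" where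
  "invariant_under f W \<longleftrightarrow> f ` W \<subseteq> W"

text \<open>
  The family of summands is a set of subspaces, so a subspace cannot occur twice; for nonzero
  summands this is no restriction. The empty family decomposes the zero space.
  In the last conjunct, \<open>f\<close> is a choice of one component \<open>f W \<in> W\<close> for each summand \<open>W\<close>.
\<close>

definition orthogonal_direct_sum :: "'a::real_inner set set \<Rightarrow> bool" where
  "orthogonal_direct_sum \<W> \<longleftrightarrow>
     finite \<W> \<and>
     (\<forall>W\<in>\<W>. subspace W) \<and>
     pairwise (\<lambda>U W. \<forall>u\<in>U. \<forall>w\<in>W. orthogonal u w) \<W> \<and>
     (\<forall>v. \<exists>!f. f \<in> (\<Pi>\<^sub>E W\<in>\<W>. W) \<and> v = (\<Sum>W\<in>\<W>. f W))"

end

theory Submission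
  imports Defs
begin

text \<open>
  A rotation \<open>\<delta>\<close> satisfies \<open>\<langle>v, \<delta> v\<rangle> = c |v|\<^sup>2\<close>, hence by polarization \<open>A = \<delta> - c\<close> is skew and \<open>A\<^sup>2\<close> is
  scalar; likewise \<open>B = \<epsilon> - d\<close>. The anticommutator \<open>AB + BA\<close> is symmetric, so it has an
  eigenvector \<open>v\<close>, and \<open>span {v, A v, B v, A B v}\<close> is invariant of dimension at most 4. If one of
  \<open>A\<close>, \<open>B\<close> is nonzero, it is a multiple of a complex structure on this span, so the dimension is
  even; otherwise the span is a line. Since \<open>A\<close> and \<open>B\<close> are skew, orthogonal complements of
  invariant subspaces are invariant, and induction on the dimension finishes the proof.
\<close>

section \<open>Orthonormal bases, projections and compactness in finite-dimensional
  subspaces\<close>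

lemma orthonormal_basis_of_finite_span:
  fixes S :: "'a::real_inner set"
  assumes "finite B" "subspace S" "S \<subseteq> span B"
  obtains C where "finite C" "pairwise orthogonal C" "\<And>x. x \<in> C \<Longrightarrow> norm x = 1"
    "span C = S" "card C = dim S" "independent C"
proof -
  obtain D where D: "D \<subseteq> S" "independent D" "S \<subseteq> span D"
    using maximal_independent_subset by blast
  have "finite D"
    using independent_span_bound[OF assms(1) D(2)] D(1) assms(3) by auto
  then obtain E where E: "finite E" "span E = span D" "pairwise orthogonal E"
    using basis_orthogonal by blast
  \<comment> \<open>None of the facts about \<open>E\<close> excludes the zero vector, so it is
    removed before normalizing.\<close>
  define C where "C = (\<lambda>x. x /\<^sub>R norm x) ` (E - {0})"
  have "finite C" using E by (simp add: C_def)
  moreover have orth: "pairwise orthogonal C"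
    using E(3) by (force simp: C_def pairwise_def orthogonal_def)
  moreover have norm1: "norm x = 1" if "x \<in> C" for x
    using that by (auto simp: C_def intro!: left_inverse)
  moreover have "span C = S"
  proof -
    have "span C = span (E - {0})"
      unfolding C_def by (rule span_image_scale) (use E in auto)
    also have "\<dots> = span D" by (simp add: E)
    also have "\<dots> = S" using D assms(2) by (simp add: span_subspace)
    finally show ?thesis .
  qed
  moreover have "independent C"
    using orth norm1 by (intro pairwise_orthogonal_independent) force+
  moreover from calculation have "card C = dim S"
    using dim_span_eq_card_independent by force
  ultimately show ?thesis using that by blast
qed

lemma inner_orthonormal_sum:
  assumes "finite C" "pairwise orthogonal C" "\<And>x. x \<in> C \<Longrightarrow> norm x = 1" "b \<in> C"
  shows "(\<Sum>x\<in>C. f x *\<^sub>R x) \<bullet> b = f b"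
proof -
  have "(\<Sum>x\<in>C. f x *\<^sub>R x) \<bullet> b = (\<Sum>x\<in>C. if x = b then f b else 0)"
    unfolding inner_sum_left
    using assms by (intro sum.cong) (auto simp: pairwise_def orthogonal_def dot_square_norm)
  then show ?thesis using assms by simp
qed

lemma orthogonal_projection_exists:
  fixes S :: "'a::real_inner set"
  assumes "finite B" "subspace S" "S \<subseteq> span B"
  obtains w where "w \<in> S" "\<And>y. y \<in> S \<Longrightarrow> orthogonal y (u - w)"
proof -
  obtain C where C: "finite C" "pairwise orthogonal C" "\<And>x. x \<in> C \<Longrightarrow> norm x = 1" "span C = S"
    using orthonormal_basis_of_finite_span[OF assms] by metis
  define w where "w = (\<Sum>x\<in>C. (u \<bullet> x) *\<^sub>R x)"
  have "w \<in> S"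
    unfolding w_def C(4)[symmetric] by (intro span_sum span_scale span_base)
  moreover have "orthogonal (u - w) x" if "x \<in> C" for x
    using inner_orthonormal_sum[OF C(1-3) that] unfolding w_def orthogonal_def by (simp add: inner_diff_left)
  then have "orthogonal y (u - w)" if "y \<in> S" for y
    using that C(4) orthogonal_to_span orthogonal_commute by metis
  ultimately show ?thesis using that by blast
qed

text \<open>Provides a compact box in which the unit sphere of \<open>span C\<close> will be found.
  Each further vector adds a compact segment to the previous box, and the sum of two compact sets is
  compact.\<close>

lemma compact_bounded_combinations:
  fixes C :: "'a::real_normed_vector set"
  assumes "finite C"
  shows "compact {(\<Sum>x\<in>C. f x *\<^sub>R x) | f. \<forall>x\<in>C. \<bar>f x\<bar> \<le> 1}"
  using assms
proof induction
  case empty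
  then show ?case by simp
next
  case (insert a C)
  let ?K = "\<lambda>C. {(\<Sum>x\<in>C. f x *\<^sub>R x) | f. \<forall>x\<in>C. \<bar>f x\<bar> \<le> 1}"
  let ?L = "(\<lambda>t. t *\<^sub>R a) ` {-1..1::real}"
  have "compact ?L"
    by (intro compact_continuous_image continuous_intros compact_Icc)
  then have "compact {x + y | x y. x \<in> ?L \<and> y \<in> ?K C}"
    using insert by (intro compact_sums)
  moreover have "?K (insert a C) = {x + y | x y. x \<in> ?L \<and> y \<in> ?K C}"
  proof (intro equalityI subsetI)
    fix z assume "z \<in> ?K (insert a C)"
    then obtain f where "z = (\<Sum>x\<in>insert a C. f x *\<^sub>R x)" "\<forall>x\<in>insert a C. \<bar>f x\<bar> \<le> 1"
      by blast
    moreover from this insert have "f a *\<^sub>R a \<in> ?L"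
      by (intro imageI) (auto simp: abs_le_iff)
    ultimately show "z \<in> {x + y | x y. x \<in> ?L \<and> y \<in> ?K C}"
      using insert by auto
  next
    fix z assume "z \<in> {x + y | x y. x \<in> ?L \<and> y \<in> ?K C}"
    then obtain t f where z: "z = t *\<^sub>R a + (\<Sum>x\<in>C. f x *\<^sub>R x)" "t \<in> {-1..1}" "\<forall>x\<in>C. \<bar>f x\<bar> \<le> 1"
      by blast
    have "(\<Sum>x\<in>C. (f(a := t)) x *\<^sub>R x) = (\<Sum>x\<in>C. f x *\<^sub>R x)"
      using insert by (intro sum.cong) auto
    then have "z = (\<Sum>x\<in>insert a C. (f(a := t)) x *\<^sub>R x)"
      using insert z by simp
    moreover have "\<forall>x\<in>insert a C. \<bar>(f(a := t)) x\<bar> \<le> 1" using z by auto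
    ultimately show "z \<in> ?K (insert a C)" by blast
  qed
  ultimately show ?case by simp
qed

text \<open>In an orthonormal basis the coefficients of a unit vector are inner products of unit
  vectors, hence at most 1 in absolute value by Cauchy-Schwarz. So the sphere is the part of a
  compact box cut out by the closed condition \<open>norm x = 1\<close>.\<close>

lemma compact_unit_sphere_finite_span:
  fixes S :: "'a::real_inner set"
  assumes "finite B" "subspace S" "S \<subseteq> span B"
  shows "compact {x \<in> S. norm x = 1}"
proof -
  obtain C where C: "finite C" "pairwise orthogonal C" "\<And>x. x \<in> C \<Longrightarrow> norm x = 1" "span C = S"
    using orthonormal_basis_of_finite_span[OF assms] by metis
  let ?K = "{(\<Sum>x\<in>C. f x *\<^sub>R x) | f. \<forall>x\<in>C. \<bar>f x\<bar> \<le> 1}"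
  have "{x \<in> S. norm x = 1} = ?K \<inter> {x. norm x = 1}"
  proof (intro equalityI subsetI)
    fix x assume x: "x \<in> {x \<in> S. norm x = 1}"
    then obtain f where f: "x = (\<Sum>y\<in>C. f y *\<^sub>R y)"
      using C(1,4) by (auto simp: span_finite)
    have "\<bar>f b\<bar> \<le> 1" if "b \<in> C" for b
      using inner_orthonormal_sum[OF C(1-3) that, of f] Cauchy_Schwarz_ineq2[of x b] x C(3)[OF that] f
      by simp
    then show "x \<in> ?K \<inter> {x. norm x = 1}" using x f by auto
  next
    fix x assume "x \<in> ?K \<inter> {x. norm x = 1}"
    then show "x \<in> {x \<in> S. norm x = 1}"
      by (auto simp: C(4)[symmetric] intro!: span_sum span_scale intro: span_base)
  qed
  then show ?thesis
    using compact_bounded_combinations[OF C(1)]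
    by (auto intro!: compact_Int_closed closed_Collect_eq continuous_intros)
qed

section \<open>Eigenvectors of symmetric operators\<close>

lemma linear_coefficient_zero:
  fixes p q :: real
  assumes "\<And>t. t * p \<le> t\<^sup>2 * q"
  shows "p = 0"
proof (rule ccontr)
  assume "p \<noteq> 0"
  \<comment> \<open>Near 0 a linear term dominates a quadratic one. At the test point
    \<open>t = s * p\<close> the left side is \<open>s * p * p\<close>, and this \<open>s\<close>
    makes the right side strictly smaller.\<close>
  define s where "s = 1 / (\<bar>q\<bar> + 1)"
  have s: "s > 0" "s * (\<bar>q\<bar> + 1) = 1" by (auto simp: s_def)
  have "s * p * p \<le> s\<^sup>2 * p\<^sup>2 * q"
    using assms[of "s * p"] by (simp add: power_mult_distrib)
  also have "\<dots> \<le> s\<^sup>2 * p\<^sup>2 * \<bar>q\<bar>"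
    by (intro mult_left_mono) auto
  also have "\<dots> < s\<^sup>2 * p\<^sup>2 * (\<bar>q\<bar> + 1)"
    using s(1) \<open>p \<noteq> 0\<close> by simp
  also have "\<dots> = s * p\<^sup>2 * (s * (\<bar>q\<bar> + 1))"
    by (simp add: power2_eq_square)
  also have "\<dots> = s * p * p" by (simp add: s(2) power2_eq_square)
  finally show False by simp
qed

text \<open>A maximizer \<open>v\<close> of the quadratic form \<open>x \<bullet> S x\<close> on the
  unit sphere of \<open>U\<close> is an eigenvector: otherwise moving from \<open>v\<close> along
  the residual \<open>S v - \<mu> v\<close> would increase the Rayleigh quotient to first
  order.\<close>

lemma symmetric_operator_has_eigenvector:
  fixes S :: "'a::real_inner \<Rightarrow> 'a"
  assumes fin: "finite B" "subspace U" "U \<subseteq> span B" and "U \<noteq> {0}"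
    and S: "bounded_linear S" "\<And>x y. S x \<bullet> y = x \<bullet> S y" "S ` U \<subseteq> U"
  obtains v \<mu> where "v \<in> U" "norm v = 1" "S v = \<mu> *\<^sub>R v"
proof -
  interpret S: bounded_linear S by fact
  let ?X = "{x \<in> U. norm x = 1}"
  obtain u where "u \<in> U" "u \<noteq> 0"
    using fin(2) \<open>U \<noteq> {0}\<close> subspace_0 by blast
  then have "u /\<^sub>R norm u \<in> ?X"
    using fin(2) by (simp add: subspace_scale)
  then have "?X \<noteq> {}" by blast
  moreover have "continuous_on ?X (\<lambda>x. x \<bullet> S x)"
    by (intro continuous_intros linear_continuous_on S)
  ultimately obtain v where v: "v \<in> ?X" and max: "\<And>x. x \<in> ?X \<Longrightarrow> x \<bullet> S x \<le> v \<bullet> S v"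
    using continuous_attains_sup[OF compact_unit_sphere_finite_span[OF fin]] by blast
  define \<mu> where "\<mu> = v \<bullet> S v"
  have vv: "v \<bullet> v = 1" using v by (simp add: dot_square_norm)
  \<comment> \<open>Homogeneity carries the bound from the sphere to all of \<open>U\<close>, so
    that the perturbed vector below need not be normalized.\<close>
  have le: "x \<bullet> S x \<le> \<mu> * (x \<bullet> x)" if "x \<in> U" for x
  proof (cases "x = 0")
    case False
    have "x /\<^sub>R norm x \<in> ?X"
      using that fin(2) False by (simp add: subspace_scale)
    from max[OF this] False show ?thesis
      by (simp add: S.scaleR \<mu>_def dot_square_norm field_simps power2_eq_square)
  qed (simp add: S.zero)
  define w where "w = S v - \<mu> *\<^sub>R v"
  have wU: "w \<in> U"
    using v S(3) fin(2) unfolding w_def by (auto intro!: subspace_diff subspace_scale)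
  have "w \<bullet> w * 2 = 0"
  \<comment> \<open>Expanding \<open>le\<close> at \<open>v + t w\<close>, the constant terms
    cancel, and the linear coefficients differ by twice \<open>w \<bullet> w\<close>.\<close>
  proof (rule linear_coefficient_zero)
    fix t :: real
    have "v + t *\<^sub>R w \<in> U"
      using wU v fin(2) by (auto intro!: subspace_add subspace_scale)
    from le[OF this]
    have "\<mu> + 2 * t * (S v \<bullet> w) + t\<^sup>2 * (w \<bullet> S w) \<le> \<mu> * (1 + 2 * t * (v \<bullet> w) + t\<^sup>2 * (w \<bullet> w))"
      using S(2)[of v w] vv
      by (simp add: S.add S.scaleR inner_add_left inner_add_right \<mu>_def[symmetric]
          inner_commute algebra_simps power2_eq_square)
    moreover have "w \<bullet> w = S v \<bullet> w - \<mu> * (v \<bullet> w)"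
      by (simp add: w_def inner_diff_left)
    then have "t * (w \<bullet> w * 2) = 2 * t * (S v \<bullet> w) - 2 * t * (\<mu> * (v \<bullet> w))"
      by algebra
    ultimately show "t * (w \<bullet> w * 2) \<le> t\<^sup>2 * (\<mu> * (w \<bullet> w) - w \<bullet> S w)"
      by (simp only: algebra_simps)
  qed
  then have "S v = \<mu> *\<^sub>R v" by (simp add: w_def)
  then show ?thesis using v that by blast
qed

section \<open>Skew operators whose square is a scalar\<close>

text \<open>Models a rotation minus its scalar part. For \<open>k > 0\<close>, dividing
  \<open>A\<close> by \<open>sqrt k\<close> gives an isometric complex structure; for
  \<open>k = 0\<close> the map \<open>A\<close> vanishes. The sign of \<open>k\<close> is not
  assumed: it follows from \<open>inner_image\<close> once a nonzero vector exists.\<close>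

locale skew_scalar_square =
  fixes A :: "'a::real_inner \<Rightarrow> 'a" and k :: real
  assumes linear: "linear A"
    and skew: "A x \<bullet> y = - (x \<bullet> A y)"
    and square: "A (A x) = - (k *\<^sub>R x)"
begin

lemma inner_image: "A x \<bullet> A y = k * (x \<bullet> y)"
  using skew[of x "A y"] by (simp add: square)

lemma self_orthogonal: "x \<bullet> A x = 0"
  using skew[of x x] by (simp add: inner_commute)

lemma bounded_linear: "bounded_linear A"
proof -
  have "norm (A x) = norm x * sqrt k" for x
    by (simp add: norm_eq_sqrt_inner inner_image real_sqrt_mult)
  then show ?thesis
    using linear by (auto simp: bounded_linear_def bounded_linear_axioms_def intro!: exI[of _ "sqrt k"])
qed

lemma k_nonneg: "0 \<le> k" if "x \<noteq> 0" for x :: 'a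
  using inner_image[of x x] that by (metis inner_ge_zero inner_gt_zero_iff mult_less_0_iff not_less)

lemma image_orthogonal_complement:
  assumes "A ` W \<subseteq> W" "\<And>w. w \<in> W \<Longrightarrow> orthogonal w u" "w \<in> W"
  shows "orthogonal w (A u)"
  using assms skew[of w u] by (auto simp: orthogonal_def)

text \<open>A weak form of the evenness of complex dimension. The vectors \<open>v\<close> and
  \<open>A v\<close> span an invariant plane; a vector of \<open>W\<close> outside it has a nonzero
  component \<open>u\<close> orthogonal to the plane, and then \<open>u\<close> and
  \<open>A u\<close> contribute two more dimensions.\<close>

lemma invariant_subspace_dim:
  assumes fin: "finite B" "subspace W" "W \<subseteq> span B"
    and inv: "A ` W \<subseteq> W" and "k > 0" and v: "v \<in> W" "v \<noteq> 0"
  shows "dim W \<ge> 2" "dim W \<noteq> 3"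
proof -
  obtain C where C: "finite C" "span C = W" "card C = dim W" "independent C"
    using orthonormal_basis_of_finite_span[OF fin] by metis
  have nz: "A x \<noteq> 0" if "x \<noteq> 0" for x
    using inner_image[of x x] that \<open>k > 0\<close> by auto
  \<comment> \<open>Lower bounds on the dimension come from orthogonal families of nonzero vectors,
    which are independent.\<close>
  have bound: "card X \<le> dim W" if "pairwise orthogonal X" "0 \<notin> X" "X \<subseteq> W" for X
    using independent_span_bound[OF C(1) pairwise_orthogonal_independent[OF that(1,2)]] that(3) C
    by auto
  have "v \<noteq> A v" using self_orthogonal[of v] v by auto
  then have card2: "card {v, A v} = 2" by simp
  have in_W: "{v, A v} \<subseteq> W" using v inv by auto
  have "pairwise orthogonal {v, A v}"
    using self_orthogonal[of v] by (auto simp: pairwise_def orthogonal_def inner_commute)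
  then show "dim W \<ge> 2"
    using bound[of "{v, A v}"] card2 in_W nz v by auto
  show "dim W \<noteq> 3"
  proof
    assume 3: "dim W = 3"
    let ?P = "span {v, A v}"
    have "\<not> W \<subseteq> ?P"
    proof
      assume "W \<subseteq> ?P"
      then have "dim W \<le> card {v, A v}" by (intro dim_le_card) auto
      with 3 card2 show False by simp
    qed
    then obtain x where x: "x \<in> W" "x \<notin> ?P" by blast
    obtain p where p: "p \<in> ?P" "\<And>y. y \<in> ?P \<Longrightarrow> orthogonal y (x - p)"
      using orthogonal_projection_exists[of "{v, A v}" ?P x] by auto
    define u where "u = x - p"
    have "p \<in> W" using p(1) in_W fin(2) by (meson span_minimal subsetD)
    then have u: "u \<in> W" "u \<noteq> 0"
      using x p fin(2) by (auto simp: u_def subspace_diff)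
    have uv: "v \<bullet> u = 0" "A v \<bullet> u = 0"
      using p(2) by (auto simp: u_def orthogonal_def intro: span_base)
    \<comment> \<open>The complement of the plane is invariant too: \<open>v \<bullet> A u\<close>
      is \<open>- (A v \<bullet> u)\<close> and \<open>A v \<bullet> A u\<close> is
      \<open>k * (v \<bullet> u)\<close>.\<close>
    then have uA: "v \<bullet> A u = 0" "A v \<bullet> A u = 0"
      using skew[of v u] inner_image[of v u] by auto
    let ?X = "{v, A v, u, A u}"
    have sv: "v \<bullet> v \<noteq> 0" "u \<bullet> u \<noteq> 0" "A v \<bullet> A v \<noteq> 0" "A u \<bullet> A u \<noteq> 0"
      using v u nz by auto
    have "pairwise orthogonal ?X"
      using uv uA self_orthogonal[of v] self_orthogonal[of u]
      by (auto simp: pairwise_def orthogonal_def inner_commute)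
    moreover have "0 \<notin> ?X" "?X \<subseteq> W" using nz v u in_W inv by auto
    moreover have "card ?X = 4"
    proof -
      \<comment> \<open>Two equal vectors that are orthogonal would have square 0, against
        \<open>sv\<close>.\<close>
      have "v \<noteq> A v" "v \<noteq> u" "v \<noteq> A u" "A v \<noteq> u" "A v \<noteq> A u" "u \<noteq> A u"
        using sv uv uA self_orthogonal[of v] self_orthogonal[of u] by metis+
      then show ?thesis by simp
    qed
    ultimately show False using bound[of ?X] 3 by simp
  qed
qed

end

section \<open>Common invariant subspaces of two such operators\<close>

locale skew_pair = A: skew_scalar_square A k + B: skew_scalar_square B l
  for A B :: "'a::real_inner \<Rightarrow> 'a" and k l
begin

lemma bounded_linear_anticommutator: "bounded_linear (\<lambda>x. A (B x) + B (A x))"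
  by (intro bounded_linear_add bounded_linear_compose[OF A.bounded_linear]
      bounded_linear_compose[OF B.bounded_linear] A.bounded_linear B.bounded_linear)

text \<open>Moving a product of two skew maps across the inner product reverses their order while
  the two signs cancel. So the adjoint of \<open>AB\<close> is \<open>BA\<close>, and their sum is
  self-adjoint.\<close>

lemma symmetric_anticommutator: "(A (B x) + B (A x)) \<bullet> y = x \<bullet> (A (B y) + B (A y))"
  by (simp add: inner_add_left inner_add_right A.skew B.skew)

text \<open>
  On an eigenvector \<open>v\<close> of \<open>AB + BA\<close> one can trade \<open>B A v\<close> for \<open>A B v\<close>, so words in \<open>A\<close> and \<open>B\<close>
  applied to \<open>v\<close> span at most four dimensions.
\<close>

lemma invariant_span_of_eigenvector:
  assumes "A (B v) + B (A v) = \<mu> *\<^sub>R v"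
  defines "G \<equiv> {v, A v, B v, A (B v)}"
  shows "A ` span G \<subseteq> span G" "B ` span G \<subseteq> span G"
proof -
  have BA: "B (A v) = \<mu> *\<^sub>R v - A (B v)"
    using assms(1) by (simp add: eq_diff_eq add.commute)
  have G: "v \<in> span G" "A v \<in> span G" "B v \<in> span G" "A (B v) \<in> span G"
    unfolding G_def by (auto intro: span_base)
  have "B (A v) \<in> span G" unfolding BA using G by (intro span_diff span_scale)
  moreover have "B (A (B v)) \<in> span G"
  proof -
    \<comment> \<open>Applying \<open>B\<close> to the relation \<open>BA\<close> produces
      \<open>B (B (A v))\<close>, which \<open>B.square\<close> reduces to a multiple of
      \<open>A v\<close>.\<close>
    have "B (A (B v)) = \<mu> *\<^sub>R B v - B (B (A v))"
      using arg_cong[OF BA, of B]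
      by (simp add: linear_diff[OF B.linear] linear_scale[OF B.linear])
    also have "\<dots> = \<mu> *\<^sub>R B v + l *\<^sub>R A v" by (simp add: B.square)
    finally show ?thesis using G by (simp add: span_add span_scale)
  qed
  ultimately have "A ` G \<subseteq> span G" "B ` G \<subseteq> span G"
    using G unfolding G_def by (auto simp: A.square B.square span_neg span_scale)
  then show "A ` span G \<subseteq> span G" "B ` span G \<subseteq> span G"
    using linear_span_image[OF A.linear, of G] linear_span_image[OF B.linear, of G]
    by (metis span_minimal subspace_span)+
qed

lemma exists_small_invariant_subspace:
  assumes fin: "finite D" "subspace U" "U \<subseteq> span D" and "U \<noteq> {0}"
    and inv: "A ` U \<subseteq> U" "B ` U \<subseteq> U"
  obtains W where "subspace W" "W \<subseteq> U" "A ` W \<subseteq> W" "B ` W \<subseteq> W" "dim W \<in> {1, 2, 4}"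
proof -
  have "(\<lambda>x. A (B x) + B (A x)) ` U \<subseteq> U"
    using inv fin(2) by (auto intro!: subspace_add)
  then obtain v \<mu> where v: "v \<in> U" "norm v = 1" "A (B v) + B (A v) = \<mu> *\<^sub>R v"
    using symmetric_operator_has_eigenvector[OF fin \<open>U \<noteq> {0}\<close> bounded_linear_anticommutator
        symmetric_anticommutator] by blast
  then have "v \<noteq> 0" by auto
  let ?G = "{v, A v, B v, A (B v)}"
  let ?W = "span ?G"
  have W: "A ` ?W \<subseteq> ?W" "B ` ?W \<subseteq> ?W" "v \<in> ?W"
    using invariant_span_of_eigenvector[OF v(3)] by (auto intro: span_base)
  have "?G \<subseteq> U" using v inv by auto
  then have WU: "?W \<subseteq> U" using fin(2) by (rule span_minimal)
  have "dim ?W \<le> card ?G" by (intro dim_le_card) auto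
  also have "\<dots> \<le> 4" by (auto simp: card_insert_if)
  finally have dim4: "dim ?W \<le> 4" .
  have "dim ?W \<in> {1, 2, 4}"
  proof (cases "k > 0 \<or> l > 0")
    case True
    then have "dim ?W \<ge> 2 \<and> dim ?W \<noteq> 3"
      using A.invariant_subspace_dim[of ?G ?W v] B.invariant_subspace_dim[of ?G ?W v] W \<open>v \<noteq> 0\<close>
      by auto
    with dim4 show ?thesis by auto
  next
    case False
    \<comment> \<open>Since \<open>v\<close> is nonzero, \<open>k\<close> and \<open>l\<close> are
      nonnegative and hence both 0. By \<open>inner_image\<close> every image has norm 0, and the
      span collapses to the line through \<open>v\<close>.\<close>
    then have kl: "k = 0" "l = 0"
      using A.k_nonneg B.k_nonneg \<open>v \<noteq> 0\<close> by force+
    have "A x = 0" "B x = 0" for x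
      using A.inner_image[of x x] B.inner_image[of x x] kl by auto
    then have "?W = span {v}"
      by (simp add: insert_commute)
    then show ?thesis
      using \<open>v \<noteq> 0\<close> dim_span_eq_card_independent[of "{v}"] by simp
  qed
  then show ?thesis using that[of ?W] W WU by auto
qed

text \<open>Stated for every invariant \<open>U\<close>, so that the induction hypothesis applies to
  the complement \<open>U'\<close> of a small invariant subspace. Only existence of components is
  tracked; their uniqueness follows later from orthogonality.\<close>

lemma orthogonal_decomposition:
  assumes "finite D" "subspace U" "U \<subseteq> span D" "A ` U \<subseteq> U" "B ` U \<subseteq> U"
  shows "\<exists>\<W>. finite \<W> \<and> pairwise (\<lambda>V W. \<forall>x\<in>V. \<forall>y\<in>W. orthogonal x y) \<W> \<and>
      (\<forall>W\<in>\<W>. subspace W \<and> W \<subseteq> U \<and> A ` W \<subseteq> W \<and> B ` W \<subseteq> W \<and> dim W \<in> {1, 2, 4}) \<and>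
      (\<forall>u\<in>U. \<exists>f. (\<forall>W\<in>\<W>. f W \<in> W) \<and> u = (\<Sum>W\<in>\<W>. f W))"
  using assms(2-)
proof (induction "dim U" arbitrary: U rule: less_induct)
  case less
  note finU = assms(1) less.prems(1,2)
  show ?case
  proof (cases "U = {0}")
    case True
    then show ?thesis by (intro exI[of _ "{}"]) (auto simp: pairwise_def)
  next
    case False
    obtain W where W: "subspace W" "W \<subseteq> U" "A ` W \<subseteq> W" "B ` W \<subseteq> W" "dim W \<in> {1, 2, 4}"
      using exists_small_invariant_subspace[OF finU False less.prems(3,4)] by blast
    obtain v where v: "v \<in> W" "v \<noteq> 0"
    proof -
      have "\<not> W \<subseteq> span {}"
        using dim_le_card[of W "{}"] W(5) by auto
      then show ?thesis using that by auto
    qed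
    define U' where "U' = U \<inter> {u. \<forall>w\<in>W. orthogonal w u}"
    have sub': "subspace U'"
      unfolding U'_def by (intro subspace_inter less.prems subspace_orthogonal_to_vectors)
    have U': "U' \<subseteq> U" "U' \<subseteq> span D" using finU by (auto simp: U'_def)
    have inv': "A ` U' \<subseteq> U'" "B ` U' \<subseteq> U'"
      using less.prems(3,4) A.image_orthogonal_complement[OF W(3)] B.image_orthogonal_complement[OF W(4)]
      by (auto simp: U'_def)
    \<comment> \<open>A nonzero \<open>v\<close> in \<open>W\<close> is orthogonal to
      \<open>U'\<close>, so adding it to an orthonormal basis of \<open>U'\<close> gives an
      independent set inside \<open>U\<close>.\<close>
    have "dim U' < dim U"
    proof -
      obtain C where C: "finite C" "span C = U" "card C = dim U"
        using orthonormal_basis_of_finite_span[OF finU] by metis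
      obtain C' where C': "finite C'" "pairwise orthogonal C'" "\<And>x. x \<in> C' \<Longrightarrow> norm x = 1"
        "span C' = U'" "card C' = dim U'"
        using orthonormal_basis_of_finite_span[OF assms(1) sub' U'(2)] by metis
      have vC': "orthogonal v x" if "x \<in> C'" for x
        using that C'(4) v span_base by (fastforce simp: U'_def)
      have "v \<notin> C'" using vC'[of v] v(2) by (auto simp: orthogonal_self)
      have "pairwise orthogonal (insert v C')"
        using C'(2) vC' by (simp add: pairwise_orthogonal_insert)
      moreover have "0 \<notin> insert v C'" using v(2) C'(3) by force
      ultimately have "independent (insert v C')"
        by (rule pairwise_orthogonal_independent)
      moreover have "insert v C' \<subseteq> span C"
        using v W(2) U'(1) C(2) C'(4) span_superset by blast
      ultimately have "card (insert v C') \<le> card C"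
        using independent_span_bound[OF C(1)] by blast
      then show ?thesis using C C' \<open>v \<notin> C'\<close> by simp
    qed
    from less.hyps[OF this sub' U'(2) inv'] obtain \<W> where
      \<W>: "finite \<W>" "pairwise (\<lambda>V W. \<forall>x\<in>V. \<forall>y\<in>W. orthogonal x y) \<W>"
        "\<forall>W\<in>\<W>. subspace W \<and> W \<subseteq> U' \<and> A ` W \<subseteq> W \<and> B ` W \<subseteq> W \<and> dim W \<in> {1, 2, 4}"
        "\<forall>u\<in>U'. \<exists>f. (\<forall>W\<in>\<W>. f W \<in> W) \<and> u = (\<Sum>W\<in>\<W>. f W)"
      by (elim exE conjE)
    have orth: "orthogonal x y \<and> orthogonal y x" if "x \<in> W" "V \<in> \<W>" "y \<in> V" for x y V
    proof -
    have "y \<in> U'" using that \<W>(3) by blast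
    then show ?thesis using that(1) orthogonal_commute[of x y] by (simp add: U'_def)
  qed
    \<comment> \<open>Otherwise \<open>v\<close> would be orthogonal to itself. This makes
      \<open>W\<close> a genuinely new index, so the component function may be redefined at
      \<open>W\<close> without changing the sum over \<open>\<W>\<close>.\<close>
    have "W \<notin> \<W>"
      using orth[OF v(1) _ v(1)] v(2) by (auto simp: orthogonal_self)
    have "\<forall>u\<in>U. \<exists>f. (\<forall>V\<in>insert W \<W>. f V \<in> V) \<and> u = (\<Sum>V\<in>insert W \<W>. f V)"
    proof
      fix u assume "u \<in> U"
      have "W \<subseteq> span D" using W(2) finU by blast
      then obtain w where w: "w \<in> W" "\<And>y. y \<in> W \<Longrightarrow> orthogonal y (u - w)"
        using orthogonal_projection_exists[OF assms(1) W(1)] by blast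
      then have "u - w \<in> U'"
        using \<open>u \<in> U\<close> W(2) less.prems(1) by (auto simp: U'_def intro: subspace_diff)
      then obtain f where f: "\<forall>V\<in>\<W>. f V \<in> V" "u - w = (\<Sum>V\<in>\<W>. f V)"
        using \<W>(4) by blast
      have "(\<Sum>V\<in>\<W>. (f(W := w)) V) = (\<Sum>V\<in>\<W>. f V)"
        using \<open>W \<notin> \<W>\<close> by (intro sum.cong) auto
      then have "u = (\<Sum>V\<in>insert W \<W>. (f(W := w)) V)"
        using f(2) \<W>(1) \<open>W \<notin> \<W>\<close> by (simp add: diff_eq_eq add.commute)
      moreover have "\<forall>V\<in>insert W \<W>. (f(W := w)) V \<in> V"
        using f(1) w(1) by auto
      ultimately show "\<exists>f. (\<forall>V\<in>insert W \<W>. f V \<in> V) \<and> u = (\<Sum>V\<in>insert W \<W>. f V)"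
        by blast
    qed
    moreover have "pairwise (\<lambda>V W. \<forall>x\<in>V. \<forall>y\<in>W. orthogonal x y) (insert W \<W>)"
      using \<W>(2) orth by (auto simp: pairwise_insert)
    moreover have "\<forall>V\<in>insert W \<W>. subspace V \<and> V \<subseteq> U \<and> A ` V \<subseteq> V \<and> B ` V \<subseteq> V \<and> dim V \<in> {1, 2, 4}"
      using W \<W>(3) U'(1) by (simp add: subset_trans[OF _ U'(1)])
    ultimately show ?thesis
      using \<W>(1) by (intro exI[of _ "insert W \<W>"] conjI finite.insertI)
  qed
qed

end

section \<open>Direct sums, and the passage between rotations and skew operators\<close>

text \<open>Orthogonality forces uniqueness: pairing the difference of two decompositions with the
  difference of their \<open>W\<close>-components leaves only the squared norm of the
  latter.\<close>

lemma orthogonal_direct_sumI: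
  fixes \<W> :: "'a::real_inner set set"
  assumes fin: "finite \<W>" and sub: "\<And>W. W \<in> \<W> \<Longrightarrow> subspace W"
    and orth: "pairwise (\<lambda>V W. \<forall>x\<in>V. \<forall>y\<in>W. orthogonal x y) \<W>"
    and ex: "\<And>v. \<exists>f. (\<forall>W\<in>\<W>. f W \<in> W) \<and> v = (\<Sum>W\<in>\<W>. f W)"
  shows "orthogonal_direct_sum \<W>"
proof -
  have unique: "f = g"
    if f: "f \<in> (\<Pi>\<^sub>E W\<in>\<W>. W)" and g: "g \<in> (\<Pi>\<^sub>E W\<in>\<W>. W)" and eq: "(\<Sum>W\<in>\<W>. f W) = (\<Sum>W\<in>\<W>. g W)" for f g
  proof (rule PiE_ext[OF f g])
    fix W assume W: "W \<in> \<W>"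
    have mem: "f V - g V \<in> V" if "V \<in> \<W>" for V
      using f g that sub by (auto intro!: subspace_diff)
    have "0 = (\<Sum>V\<in>\<W>. f V - g V) \<bullet> (f W - g W)" using eq by (simp add: sum_subtractf)
    also have "\<dots> = (\<Sum>V\<in>\<W>. if V = W then (f W - g W) \<bullet> (f W - g W) else 0)"
      unfolding inner_sum_left
    proof (rule sum.cong[OF refl])
      fix V assume "V \<in> \<W>"
      then show "(f V - g V) \<bullet> (f W - g W) = (if V = W then (f W - g W) \<bullet> (f W - g W) else 0)"
        using orth mem W by (auto simp: pairwise_def orthogonal_def)
    qed
    also have "\<dots> = (f W - g W) \<bullet> (f W - g W)" using fin W by simp
    finally show "f W = g W" by simp
  qed
  have "\<exists>!f. f \<in> (\<Pi>\<^sub>E W\<in>\<W>. W) \<and> v = (\<Sum>W\<in>\<W>. f W)" for v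
  proof -
    obtain f where f: "\<forall>W\<in>\<W>. f W \<in> W" "v = (\<Sum>W\<in>\<W>. f W)" using ex by blast
    \<comment> \<open>Restriction fixes the values outside \<open>\<W>\<close> to
      \<open>undefined\<close>, so that uniqueness holds for \<open>f\<close> as a function on all
      sets.\<close>
    then have "restrict f \<W> \<in> (\<Pi>\<^sub>E W\<in>\<W>. W) \<and> v = (\<Sum>W\<in>\<W>. restrict f \<W> W)" by auto
    then show ?thesis using unique by blast
  qed
  then show ?thesis using assms by (auto simp: orthogonal_direct_sum_def)
qed

text \<open>With \<open>c\<close> the cosine of the rotation angle, the symmetric part of
  \<open>\<delta>\<close> is \<open>c\<close> times the identity. Orthogonality then yields the
  quadratic equation \<open>\<delta>\<^sup>2 - 2 c \<delta> + 1 = 0\<close>, and completing the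
  square gives \<open>k = 1 - c\<^sup>2\<close>, the squared sine.\<close>

lemma rotation_skew_part:
  assumes "rotation \<delta>"
  obtains c k where "skew_scalar_square (\<lambda>x. \<delta> x - c *\<^sub>R x) k"
proof -
  have lin: "linear \<delta>" and iso: "\<And>v w. \<delta> v \<bullet> \<delta> w = v \<bullet> w"
    and angle: "\<And>v w. norm v = 1 \<Longrightarrow> norm w = 1 \<Longrightarrow> v \<bullet> \<delta> v = w \<bullet> \<delta> w"
    using assms unfolding rotation_def orthogonal_transformation_def by blast+
  \<comment> \<open>In the zero space there are no unit vectors and any \<open>c\<close> will
    do.\<close>
  obtain c where c: "\<And>v. norm v = 1 \<Longrightarrow> v \<bullet> \<delta> v = c"
    using angle by metis
  have quad: "v \<bullet> \<delta> v = c * (v \<bullet> v)" for v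
  proof (cases "v = 0")
    case False
    then have "norm (v /\<^sub>R norm v) = 1" by simp
    from c[OF this] False show ?thesis
      by (simp add: linear_scale[OF lin] dot_square_norm field_simps power2_eq_square)
  qed simp
  have polar: "v \<bullet> \<delta> w + w \<bullet> \<delta> v = 2 * c * (v \<bullet> w)" for v w
    using quad[of "v + w"] quad[of v] quad[of w]
    by (simp add: linear_add[OF lin] inner_add_left inner_add_right inner_commute algebra_simps)
  have square: "\<delta> (\<delta> v) = (2 * c) *\<^sub>R \<delta> v - v" for v
  proof -
    \<comment> \<open>In \<open>polar\<close> at \<open>\<delta> v\<close> and \<open>w\<close>, the
      term \<open>\<delta> v \<bullet> \<delta> w\<close> becomes \<open>v \<bullet> w\<close> by
      isometry. As \<open>w\<close> is arbitrary, the vector itself is 0.\<close>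
    have "w \<bullet> (\<delta> (\<delta> v) - ((2 * c) *\<^sub>R \<delta> v - v)) = 0" for w
      using polar[of "\<delta> v" w] iso[of v w]
      by (simp add: inner_diff_right inner_commute algebra_simps)
    then show ?thesis by (metis inner_eq_zero_iff eq_iff_diff_eq_0)
  qed
  have "skew_scalar_square (\<lambda>x. \<delta> x - c *\<^sub>R x) (1 - c\<^sup>2)"
  proof
    show "\<delta> (x + y) - c *\<^sub>R (x + y) = \<delta> x - c *\<^sub>R x + (\<delta> y - c *\<^sub>R y)" for x y
      by (simp add: linear_add[OF lin] algebra_simps)
    show "\<delta> (r *\<^sub>R x) - c *\<^sub>R r *\<^sub>R x = r *\<^sub>R (\<delta> x - c *\<^sub>R x)" for r x
      by (simp add: linear_scale[OF lin] algebra_simps)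
    show "(\<delta> x - c *\<^sub>R x) \<bullet> y = - (x \<bullet> (\<delta> y - c *\<^sub>R y))" for x y
      using polar[of x y] by (simp add: inner_diff_left inner_diff_right inner_commute algebra_simps)
    show "\<delta> (\<delta> x - c *\<^sub>R x) - c *\<^sub>R (\<delta> x - c *\<^sub>R x) = - ((1 - c\<^sup>2) *\<^sub>R x)" for x
    proof -
      have "(2 * c) *\<^sub>R \<delta> x = c *\<^sub>R \<delta> x + c *\<^sub>R \<delta> x"
        by (simp flip: scaleR_add_left)
      then show ?thesis
        by (simp add: linear_diff[OF lin] linear_scale[OF lin] square algebra_simps power2_eq_square)
    qed
  qed
  then show ?thesis using that by blast
qed

lemma invariant_under_shift:
  assumes "subspace W" "(\<lambda>x. \<delta> x - c *\<^sub>R x) ` W \<subseteq> W"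
  shows "invariant_under \<delta> W"
  unfolding invariant_under_def
proof (intro image_subsetI)
  fix x assume x: "x \<in> W"
  then have "(\<delta> x - c *\<^sub>R x) + c *\<^sub>R x \<in> W"
    using assms by (intro subspace_add subspace_scale) auto
  then show "\<delta> x \<in> W" by simp
qed

theorem proposition1p1:
  fixes \<delta> \<epsilon> :: "'a::real_inner \<Rightarrow> 'a"
  assumes "finite_dimensional TYPE('a)"
    and "rotation \<delta>"
    and "rotation \<epsilon>"
  shows "\<exists>\<W>::'a set set.
           orthogonal_direct_sum \<W> \<and>
           (\<forall>W\<in>\<W>. invariant_under \<delta> W \<and> invariant_under \<epsilon> W \<and> dim W \<in> {1, 2, 4})"
proof -
  obtain D :: "'a set" where D: "finite D" "span D = UNIV"
    using assms(1) unfolding finite_dimensional_def by blast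
  obtain c k where A: "skew_scalar_square (\<lambda>x. \<delta> x - c *\<^sub>R x) k"
    using rotation_skew_part[OF assms(2)] by blast
  obtain d l where B: "skew_scalar_square (\<lambda>x. \<epsilon> x - d *\<^sub>R x) l"
    using rotation_skew_part[OF assms(3)] by blast
  interpret skew_pair "\<lambda>x. \<delta> x - c *\<^sub>R x" "\<lambda>x. \<epsilon> x - d *\<^sub>R x" k l
    using A B by (rule skew_pair.intro)
  obtain \<W> where \<W>: "finite \<W>" "pairwise (\<lambda>V W. \<forall>x\<in>V. \<forall>y\<in>W. orthogonal x y) \<W>"
    "\<forall>W\<in>\<W>. subspace W \<and> W \<subseteq> UNIV \<and> (\<lambda>x. \<delta> x - c *\<^sub>R x) ` W \<subseteq> W \<and>
        (\<lambda>x. \<epsilon> x - d *\<^sub>R x) ` W \<subseteq> W \<and> dim W \<in> {1, 2, 4}"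
    "\<forall>v\<in>UNIV. \<exists>f. (\<forall>W\<in>\<W>. f W \<in> W) \<and> v = (\<Sum>W\<in>\<W>. f W)"
    \<comment> \<open>The whole space serves as \<open>U\<close>; its invariance under both skew
      parts is immediate.\<close>
    using orthogonal_decomposition[OF D(1) subspace_UNIV, unfolded D(2), OF subset_UNIV subset_UNIV subset_UNIV]
    by (elim exE conjE)
  have "orthogonal_direct_sum \<W>"
    using \<W> by (intro orthogonal_direct_sumI) auto
  moreover have "invariant_under \<delta> W \<and> invariant_under \<epsilon> W \<and> dim W \<in> {1, 2, 4}" if "W \<in> \<W>" for W
    using bspec[OF \<W>(3) that] invariant_under_shift by blast
  ultimately show ?thesis by blast
qed

end
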